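(* Let $Z$ be a real-valued Lévy process, let $c>0$, and let $\mathcal{E}$ be a vector space of functions on $[0,1]$ such that almost surely all increment functions $\eta_{x,\lambda}$ ($x\ge 0$, $\lambda>0$) of $Z$ lie in $\mathcal{E}$. Let $d$ be a distance on $\mathcal{E}$. Assume that a functional Erdős–Rényi law (FERL) holds for $(\mathcal{L}_n^{\mathbb{N}})$ in $(\mathcal{E},d)$ with some limit set $\mathcal{K}\subset\mathcal{E}$, and that condition $(\Delta^d)$ holds: for all $\epsilon>0$, the set $\{\Delta_n^d(\epsilon)\text{ infinitely often in }n\}$ is negligible, where $$\Delta_n^d(\epsilon):=\{\exists x\in[0,n-A_n]\text{ such that }d(\eta_{x,A_n},\eta_{\lfloor x\rfloor,A_n})\ge\epsilon\}.$$ Then the FERL holds for $(\mathcal{L}_n)$ in $(\mathcal{E},d)$ with the same limit set $\mathcal{K}$.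
   Context: A Lévy process $Z=\{Z(t):t\ge0\}$ is a stochastically continuous real-valued process with stationary independent increments and $Z(0)=0$ a.s.; it is defined on a probability space $(\Omega,\mathcal{F},P)$, and all its sample paths are assumed càdlàg on $[0,\infty)$. For $x\ge0$, $\lambda>0$: $\eta_{x,\lambda}:[0,1]\to\mathbb{R}$, $\eta_{x,\lambda}(s)=\lambda^{-1}(Z(x+s\lambda)-Z(x))$. For $n>1$, $A_n:=\lfloor c\log n\rfloor$; $\mathcal{L}_n:=\{\eta_{x,A_n}:x\in[0,n-A_n]\}$ and $\mathcal{L}_n^{\mathbb{N}}:=\{\eta_{x,A_n}:x\in[0,n-A_n]\cap\mathbb{N}\}$, with $0\in\mathbb{N}$. Only integers $n$ with $1\le A_n\le n$ are considered (this holds for all large $n$). A subset of $\Omega$ is negligible if it is contained in a set of $\mathcal{F}$ of probability $0$; $\mathcal{N}^{c}$ is the class of complements of negligible sets. For subsets $E_n$ of $\Omega$, $\{E_n\text{ ult.}\}=\bigcup_{n>1}\bigcap_{k\ge n}E_k$ and $\{E_n\text{ infinitely often}\}=\bigcap_{n>1}\bigcup_{k\ge n}E_k$. For $K\subset\mathcal{E}$ and $\epsilon>0$, $K^{\epsilon;d}:=\{f\in\mathcal{E}:\exists g\in K,\ d(f,g)<\epsilon\}$. A FERL holds for $(\mathcal{L}_n)$ in $(\mathcal{E},d)$ with limit set $\mathcal{K}$ if for every $\epsilon>0$, $\{\mathcal{L}_n\subset\mathcal{K}^{\epsilon;d}\text{ ult.}\}\in\mathcal{N}^{c}$ and $\{\mathcal{K}\subset(\mathcal{L}_n)^{\epsilon;d}\text{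 ult.}\}\in\mathcal{N}^{c}$; similarly for $(\mathcal{L}_n^{\mathbb{N}})$. *)

theory Defs
  imports "HOL-Probability.Probability"
begin

locale levy_process = prob_space M for M :: "'a measure" +
  fixes Z :: "real \<Rightarrow> 'a \<Rightarrow> real"
  assumes random_variable_Z: "\<And>t. t \<ge> 0 \<Longrightarrow> random_variable borel (Z t)"
    and start_zero: "AE \<omega> in M. Z 0 \<omega> = 0"
    and indep_increments:
      "\<And>(t :: nat \<Rightarrow> real) n. 0 \<le> t 0 \<Longrightarrow> (\<And>i. i < n \<Longrightarrow> t i < t (Suc i)) \<Longrightarrow>
         indep_vars (\<lambda>_. borel) (\<lambda>i \<omega>. Z (t (Suc i)) \<omega> - Z (t i) \<omega>) {..<n}"
    and stationary_increments:
      "\<And>s t. s \<ge> 0 \<Longrightarrow> t \<ge> 0 \<Longrightarrow>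
         distr M borel (\<lambda>\<omega>. Z (s + t) \<omega> - Z s \<omega>) = distr M borel (\<lambda>\<omega>. Z t \<omega> - Z 0 \<omega>)"
    and stochastically_continuous:
      "\<And>t \<epsilon>. t \<ge> 0 \<Longrightarrow> \<epsilon> > 0 \<Longrightarrow>
         ((\<lambda>s. prob {\<omega> \<in> space M. \<bar>Z s \<omega> - Z t \<omega>\<bar> > \<epsilon>}) \<longlongrightarrow> 0) (at t within {0..})"
    and right_continuous_paths:
      "\<And>\<omega> t. \<omega> \<in> space M \<Longrightarrow> t \<ge> 0 \<Longrightarrow> continuous (at_right t) (\<lambda>s. Z s \<omega>)"
    and left_limits_paths:
      "\<And>\<omega> t. \<omega> \<in> space M \<Longrightarrow> t > 0 \<Longrightarrow> \<exists>l. ((\<lambda>s. Z s \<omega>) \<longlongrightarrow> l) (at_left t)"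

text \<open>
  A function on [0,1] is an element of \<open>extensional {0..1}\<close>, so that equality of such functions
  is equality on [0,1]. Sums and scalar multiples have to be restricted to [0,1] again.
\<close>

definition function_vector_space :: "(real \<Rightarrow> real) set \<Rightarrow> bool" where
  "function_vector_space \<E> \<longleftrightarrow>
     \<E> \<subseteq> extensional {0..1} \<and>
     (\<lambda>s\<in>{0..1}. 0) \<in> \<E> \<and>
     (\<forall>f\<in>\<E>. \<forall>g\<in>\<E>. (\<lambda>s\<in>{0..1}. f s + g s) \<in> \<E>) \<and>
     (\<forall>a. \<forall>f\<in>\<E>. (\<lambda>s\<in>{0..1}. a * f s) \<in> \<E>)"

definition eta :: "(real \<Rightarrow> 'a \<Rightarrow> real) \<Rightarrow> real \<Rightarrow> real \<Rightarrow> 'a \<Rightarrow> real \<Rightarrow> real" where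
  "eta Z x l \<omega> = (\<lambda>s\<in>{0..1}. inverse l * (Z (x + s * l) \<omega> - Z x \<omega>))"

definition A :: "real \<Rightarrow> nat \<Rightarrow> nat" where
  "A c n = nat \<lfloor>c * ln (real n)\<rfloor>"

definition increments ::
    "(real \<Rightarrow> 'a \<Rightarrow> real) \<Rightarrow> real \<Rightarrow> nat \<Rightarrow> 'a \<Rightarrow> (real \<Rightarrow> real) set" where
  "increments Z c n \<omega> =
     {eta Z x (real (A c n)) \<omega> | x. x \<in> {0..real n - real (A c n)}}"

definition nat_increments ::
    "(real \<Rightarrow> 'a \<Rightarrow> real) \<Rightarrow> real \<Rightarrow> nat \<Rightarrow> 'a \<Rightarrow> (real \<Rightarrow> real) set" where
  "nat_increments Z c n \<omega> =
     {eta Z x (real (A c n)) \<omega> | x. x \<in> {0..real n - real (A c n)} \<inter> \<nat>}"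

definition negligible_in :: "'a measure \<Rightarrow> 'a set \<Rightarrow> bool" where
  "negligible_in M E \<longleftrightarrow> (\<exists>N\<in>null_sets M. E \<subseteq> N)"

definition conegligible_in :: "'a measure \<Rightarrow> 'a set \<Rightarrow> bool" where
  "conegligible_in M E \<longleftrightarrow> E \<subseteq> space M \<and> negligible_in M (space M - E)"

text \<open>
  The index of a sequence of events only ranges over the integers \<open>n > 1\<close> with
  \<open>1 \<le> A c n \<le> n\<close>, which for \<open>c > 0\<close> are all large integers.
\<close>

definition admissible :: "real \<Rightarrow> nat \<Rightarrow> bool" where
  "admissible c n \<longleftrightarrow> 1 < n \<and> 1 \<le> A c n \<and> A c n \<le> n"

definition ult :: "'a measure \<Rightarrow> real \<Rightarrow> (nat \<Rightarrow> 'a set) \<Rightarrow> 'a set" where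
  "ult M c E = {\<omega> \<in> space M. \<exists>n>1. \<forall>k\<ge>n. admissible c k \<longrightarrow> \<omega> \<in> E k}"

definition infinitely_often :: "'a measure \<Rightarrow> real \<Rightarrow> (nat \<Rightarrow> 'a set) \<Rightarrow> 'a set" where
  "infinitely_often M c E = {\<omega> \<in> space M. \<forall>n>1. \<exists>k\<ge>n. admissible c k \<and> \<omega> \<in> E k}"

definition enlargement ::
    "'f set \<Rightarrow> ('f \<Rightarrow> 'f \<Rightarrow> real) \<Rightarrow> 'f set \<Rightarrow> real \<Rightarrow> 'f set" where
  "enlargement \<E> d K \<epsilon> = {f \<in> \<E>. \<exists>g\<in>K. d f g < \<epsilon>}"

definition FERL ::
    "'a measure \<Rightarrow> real \<Rightarrow> 'f set \<Rightarrow> ('f \<Rightarrow> 'f \<Rightarrow> real) \<Rightarrow> (nat \<Rightarrow> 'a \<Rightarrow> 'f set) \<Rightarrow> 'f set \<Rightarrow> bool" where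
  "FERL M c \<E> d L K \<longleftrightarrow>
     (\<forall>\<epsilon>>0.
        conegligible_in M (ult M c (\<lambda>n. {\<omega> \<in> space M. L n \<omega> \<subseteq> enlargement \<E> d K \<epsilon>})) \<and>
        conegligible_in M (ult M c (\<lambda>n. {\<omega> \<in> space M. K \<subseteq> enlargement \<E> d (L n \<omega>) \<epsilon>})))"

definition Delta_event ::
    "'a measure \<Rightarrow> (real \<Rightarrow> 'a \<Rightarrow> real) \<Rightarrow> real \<Rightarrow>
     ((real \<Rightarrow> real) \<Rightarrow> (real \<Rightarrow> real) \<Rightarrow> real) \<Rightarrow> real \<Rightarrow> nat \<Rightarrow> 'a set" where
  "Delta_event M Z c d \<epsilon> n =
     {\<omega> \<in> space M. \<exists>x\<in>{0..real n - real (A c n)}.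
        d (eta Z x (real (A c n)) \<omega>) (eta Z (of_int \<lfloor>x\<rfloor>) (real (A c n)) \<omega>) \<ge> \<epsilon>}"

definition Delta_condition ::
    "'a measure \<Rightarrow> (real \<Rightarrow> 'a \<Rightarrow> real) \<Rightarrow> real \<Rightarrow>
     ((real \<Rightarrow> real) \<Rightarrow> (real \<Rightarrow> real) \<Rightarrow> real) \<Rightarrow> bool" where
  "Delta_condition M Z c d \<longleftrightarrow>
     (\<forall>\<epsilon>>0. negligible_in M (infinitely_often M c (Delta_event M Z c d \<epsilon>)))"

end

theory Submission
  imports Defs
begin

text \<open>
  If \<open>x \<in> [0, n - A\<^sub>n]\<close> then \<open>\<lfloor>x\<rfloor> \<in> [0, n - A\<^sub>n] \<inter> \<nat>\<close>. Off the event \<open>\<Delta>\<^sub>n(\<epsilon>/2)\<close> every increment is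
  therefore \<open>\<epsilon>/2\<close>-close to an increment with integer starting point, which is \<open>\<epsilon>/2\<close>-close to \<open>K\<close>.
  The second half of the law is immediate, since the integer increments are among all increments.
\<close>

text \<open>The AE filter, too, only asks that the exceptional set lie inside a null set, with no
  measurability of \<open>E\<close> itself. Both halves of the law thus become AE statements, which
  can be intersected and weakened freely.\<close>

lemma conegligible_in_iff_AE:
  assumes "E \<subseteq> space M"
  shows "conegligible_in M E \<longleftrightarrow> (AE \<omega> in M. \<omega> \<in> E)"
proof -
  have "{\<omega> \<in> space M. \<omega> \<notin> E} = space M - E"
    by blast
  then show ?thesis
    using assms by (simp add: conegligible_in_def negligible_in_def eventually_ae_filter)
qed

lemma negligible_in_imp_AE:
  assumes "negligible_in M E"
  shows "AE \<omega> in M. \<omega> \<notin> E"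
  using assms by (auto simp: negligible_in_def intro: AE_I')

lemma ult_subset_space: "ult M c E \<subseteq> space M"
  by (auto simp: ult_def)

lemma ult_mono:
  assumes "\<And>n. E n \<subseteq> F n"
  shows "ult M c E \<subseteq> ult M c F"
  unfolding ult_def using assms by (intro Collect_mono) (meson subsetD)

text \<open>Failing to lie in \<open>F\<close> infinitely often means avoiding \<open>F k\<close> at
  all admissible \<open>k\<close> from some index on; past the larger of the two thresholds both
  properties hold.\<close>

lemma ult_diff_infinitely_often:
  "ult M c E - infinitely_often M c F \<subseteq> ult M c (\<lambda>n. E n - F n)"
proof
  fix \<omega> assume \<omega>: "\<omega> \<in> ult M c E - infinitely_often M c F"
  then obtain m where m: "m > 1" "\<forall>k\<ge>m. admissible c k \<longrightarrow> \<omega> \<in> E k"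
    by (auto simp: ult_def)
  from \<omega> obtain m' where m': "m' > 1" "\<forall>k\<ge>m'. admissible c k \<longrightarrow> \<omega> \<notin> F k"
    by (auto simp: ult_def infinitely_often_def)
  have "max m m' > 1" "\<forall>k\<ge>max m m'. admissible c k \<longrightarrow> \<omega> \<in> E k - F k"
    using m m' by auto
  then show "\<omega> \<in> ult M c (\<lambda>n. E n - F n)"
    using \<omega> unfolding ult_def by blast
qed

lemma nat_increments_subset: "nat_increments Z c n \<omega> \<subseteq> increments Z c n \<omega>"
  by (auto simp: nat_increments_def increments_def)

lemma enlargement_mono: "K \<subseteq> L \<Longrightarrow> enlargement \<E> d K \<epsilon> \<subseteq> enlargement \<E> d L \<epsilon>"
  by (auto simp: enlargement_def)

lemma eta_floor_in_nat_increments: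
  assumes "x \<in> {0..real n - real (A c n)}"
  shows "eta Z (of_int \<lfloor>x\<rfloor>) (real (A c n)) \<omega> \<in> nat_increments Z c n \<omega>"
proof -
  have "real_of_int \<lfloor>x\<rfloor> = real (nat \<lfloor>x\<rfloor>)"
    using assms by simp
  then have "real_of_int \<lfloor>x\<rfloor> \<in> \<nat>"
    by (metis of_nat_in_Nats)
  then have "real_of_int \<lfloor>x\<rfloor> \<in> {0..real n - real (A c n)} \<inter> \<nat>"
    using assms of_int_floor_le[of x] by (auto simp del: of_int_floor_le)
  then show ?thesis
    by (auto simp: nat_increments_def)
qed

text \<open>The pathwise core of the argument, for a fixed outcome and a fixed \<open>n\<close>: the
  increment started at the floor of \<open>x\<close> serves as midpoint in a triangle inequality, so
  the two tolerances add up.\<close>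

lemma increments_subset_enlargement:
  assumes "Metric_space \<E> d" "K \<subseteq> \<E>" "admissible c n" "\<omega> \<in> space M"
    and paths: "\<forall>x\<ge>0. \<forall>l>0. eta Z x l \<omega> \<in> \<E>"
    and nat: "nat_increments Z c n \<omega> \<subseteq> enlargement \<E> d K \<epsilon>"
    and Delta: "\<omega> \<notin> Delta_event M Z c d \<delta> n"
  shows "increments Z c n \<omega> \<subseteq> enlargement \<E> d K (\<epsilon> + \<delta>)"
proof
  interpret Metric_space \<E> d by fact
  fix f assume "f \<in> increments Z c n \<omega>"
  then obtain x where x: "x \<in> {0..real n - real (A c n)}"
    and f: "f = eta Z x (real (A c n)) \<omega>"
    by (auto simp: increments_def)
  define g where "g = eta Z (of_int \<lfloor>x\<rfloor>) (real (A c n)) \<omega>"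
  have "g \<in> enlargement \<E> d K \<epsilon>"
    unfolding g_def using nat eta_floor_in_nat_increments[OF x] by (rule subsetD)
  then obtain h where h: "h \<in> K" "d g h < \<epsilon>" and "g \<in> \<E>"
    by (auto simp: enlargement_def)
  \<comment> \<open>Admissibility gives \<open>A c n \<ge> 1\<close>, so the window length is
    positive, as \<open>paths\<close> requires.\<close>
  have "f \<in> \<E>"
    using x f paths \<open>admissible c n\<close> by (auto simp: admissible_def)
  \<comment> \<open>Otherwise \<open>x\<close> itself would witness
    \<open>Delta_event\<close>.\<close>
  have "d f g < \<delta>"
    using Delta x \<open>\<omega> \<in> space M\<close> by (force simp: Delta_event_def f g_def)
  moreover have "d f h \<le> d f g + d g h"
    using \<open>f \<in> \<E>\<close> \<open>g \<in> \<E>\<close> h \<open>K \<subseteq> \<E>\<close> by (intro triangle) auto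
  ultimately show "f \<in> enlargement \<E> d K (\<epsilon> + \<delta>)"
    using h \<open>f \<in> \<E>\<close> by (force simp: enlargement_def)
qed

theorem lemma7:
  fixes M :: "'a measure" and Z :: "real \<Rightarrow> 'a \<Rightarrow> real" and c :: real
    and \<E> :: "(real \<Rightarrow> real) set" and d :: "(real \<Rightarrow> real) \<Rightarrow> (real \<Rightarrow> real) \<Rightarrow> real"
    and K :: "(real \<Rightarrow> real) set"
  assumes "levy_process M Z"
    and "c > 0"
    and "function_vector_space \<E>"
    and "AE \<omega> in M. \<forall>x\<ge>0. \<forall>l>0. eta Z x l \<omega> \<in> \<E>"
    and "Metric_space \<E> d"
    and "K \<subseteq> \<E>"
    and "FERL M c \<E> d (nat_increments Z c) K"
    and "Delta_condition M Z c d"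
  shows "FERL M c \<E> d (increments Z c) K"
  unfolding FERL_def conegligible_in_iff_AE[OF ult_subset_space]
proof (intro allI impI conjI)
  fix \<epsilon> :: real assume "\<epsilon> > 0"
  \<comment> \<open>The tolerance is split evenly between the integer law and the Delta
    condition.\<close>
  define N where "N = (\<lambda>n. {\<omega> \<in> space M. nat_increments Z c n \<omega> \<subseteq> enlargement \<E> d K (\<epsilon>/2)})"
  define D where "D = Delta_event M Z c d (\<epsilon>/2)"
  have "AE \<omega> in M. \<omega> \<in> ult M c N"
    using assms(7) \<open>\<epsilon> > 0\<close>
    by (simp add: FERL_def conegligible_in_iff_AE[OF ult_subset_space] N_def)
  moreover have "AE \<omega> in M. \<omega> \<notin> infinitely_often M c D"
    using assms(8) \<open>\<epsilon> > 0\<close> by (intro negligible_in_imp_AE) (simp add: Delta_condition_def D_def)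
  ultimately show "AE \<omega> in M. \<omega> \<in> ult M c
      (\<lambda>n. {\<omega> \<in> space M. increments Z c n \<omega> \<subseteq> enlargement \<E> d K \<epsilon>})"
    using assms(4)
  proof eventually_elim
    case (elim \<omega>)
    have "\<omega> \<in> ult M c (\<lambda>n. N n - D n)"
      using elim(1,2) ult_diff_infinitely_often[of M c N D] by blast
    \<comment> \<open>Restricting to admissible \<open>n\<close> is enough, since \<open>ult\<close>
      tests no other indices.\<close>
    moreover have "increments Z c n \<omega> \<subseteq> enlargement \<E> d K \<epsilon>"
      if "\<omega> \<in> N n - D n" "admissible c n" for n
      using increments_subset_enlargement[OF assms(5,6) that(2) _ elim(3), of M "\<epsilon>/2" "\<epsilon>/2"] that(1)
      by (auto simp: N_def D_def)
    ultimately show ?case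
      by (auto simp: ult_def)
  qed
next
  fix \<epsilon> :: real assume "\<epsilon> > 0"
  then have "AE \<omega> in M. \<omega> \<in> ult M c
      (\<lambda>n. {\<omega> \<in> space M. K \<subseteq> enlargement \<E> d (nat_increments Z c n \<omega>) \<epsilon>})"
    using assms(7) by (simp add: FERL_def conegligible_in_iff_AE[OF ult_subset_space])
  \<comment> \<open>A larger family has a larger neighbourhood, so this inclusion holds outcome by
    outcome and with the same \<open>\<epsilon>\<close>.\<close>
  moreover have "ult M c (\<lambda>n. {\<omega> \<in> space M. K \<subseteq> enlargement \<E> d (nat_increments Z c n \<omega>) \<epsilon>})
      \<subseteq> ult M c (\<lambda>n. {\<omega> \<in> space M. K \<subseteq> enlargement \<E> d (increments Z c n \<omega>) \<epsilon>})"
    by (intro ult_mono Collect_mono impI conjI)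
      (auto dest: subset_trans[OF _ enlargement_mono[OF nat_increments_subset]])
  ultimately show "AE \<omega> in M. \<omega> \<in> ult M c
      (\<lambda>n. {\<omega> \<in> space M. K \<subseteq> enlargement \<E> d (increments Z c n \<omega>) \<epsilon>})"
    by (rule eventually_mono[OF _ subsetD])
qed

end
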